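(* Let $(S_n)_{n\ge 0}$ be a transient random walk on a countable group $G$ started at the identity element $e$, let $\gamma=P(S_n\ne e,\ \forall n\ge 1)>0$ and $\tau=\inf\{n\ge 1: S_n=e\}$ (with $\inf\emptyset=\infty$). Assume $P(\tau<\infty)>0$ (equivalently $\gamma<1$) and $E(\tau\mid \tau<\infty)<\infty$. Let $f:\mathbb{Z}_+\to\mathbb{R}$ be given by $f(0)=0$ and $f(j)=(1-\gamma)^{-j/2}$ for $j\ge 1$. Then $\sum_{j=1}^\infty f(j)^2(1-\gamma)^j/j=\infty$, while $\sum_{j=1}^\infty f(j)^2(1-\gamma)^j/j^{1+\delta}<\infty$ for every $\delta>0$, and $G_n(f)/n$ does not converge in $L^2$ as $n\to\infty$.
   Context: $G$ is a countable group (written multiplicatively) with identity $e$. The random walk is $S_0=e$ almost surely and $S_n=\xi_1\xi_2\cdots\xi_n$ for $n\ge 1$, where $(\xi_n)_{n\ge1}$ is a sequence of independent and identically distributed $G$-valued random variables. Transience means $P(S_n\ne e,\ \forall n\ge 1)>0$. $\mathbb{Z}_+=\{0,1,2,\dots\}$. The local time of $x\in G$ up to time $n\ge 0$ is $\ell(n,x)=\sum_{i=0}^{n}\mathbb{I}_{(S_i=x)}$, where $\mathbb{I}$ is the indicator. For $f:\mathbb{Z}_+\to\mathbb{R}$ with $f(0)=0$ and $n\ge 1$, $G_n(f)=\sum_{x\in G} f(\ell(n-1,x))$ (a sum with finitely many nonzero terms). *)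

theory Defs
  imports "HOL-Probability.Probability" "HOL-Algebra.Group"
begin

text \<open>The steps are \<open>\<xi> 1, \<xi> 2, \<dots>\<close>; the value \<open>\<xi> 0\<close> is unconstrained and never used.\<close>

locale random_walk = group G + prob_space M
  for G :: "('g, 'b) monoid_scheme" (structure) and M :: "'a measure" +
  fixes \<xi> :: "nat \<Rightarrow> 'a \<Rightarrow> 'g"
  assumes countable_carrier: "countable (carrier G)"
    and indep_steps: "indep_vars (\<lambda>_. count_space (carrier G)) \<xi> {1..}"
    and ident_distr_steps: "\<And>n. n \<ge> 1 \<Longrightarrow>
      distr M (count_space (carrier G)) (\<xi> n) = distr M (count_space (carrier G)) (\<xi> 1)"

primrec walk :: "('g, 'b) monoid_scheme \<Rightarrow> (nat \<Rightarrow> 'a \<Rightarrow> 'g) \<Rightarrow> nat \<Rightarrow> 'a \<Rightarrow> 'g" where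
  "walk G \<xi> 0 \<omega> = \<one>\<^bsub>G\<^esub>"
| "walk G \<xi> (Suc n) \<omega> = walk G \<xi> n \<omega> \<otimes>\<^bsub>G\<^esub> \<xi> (Suc n) \<omega>"

definition escape_prob ::
    "('g, 'b) monoid_scheme \<Rightarrow> 'a measure \<Rightarrow> (nat \<Rightarrow> 'a \<Rightarrow> 'g) \<Rightarrow> real" where
  "escape_prob G M \<xi> = measure M {\<omega> \<in> space M. \<forall>n\<ge>1. walk G \<xi> n \<omega> \<noteq> \<one>\<^bsub>G\<^esub>}"

definition transient ::
    "('g, 'b) monoid_scheme \<Rightarrow> 'a measure \<Rightarrow> (nat \<Rightarrow> 'a \<Rightarrow> 'g) \<Rightarrow> bool" where
  "transient G M \<xi> \<longleftrightarrow> escape_prob G M \<xi> > 0"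

text \<open>In \<^typ>\<open>enat\<close> the infimum of the empty set is \<open>\<infinity>\<close>.\<close>

definition return_time ::
    "('g, 'b) monoid_scheme \<Rightarrow> (nat \<Rightarrow> 'a \<Rightarrow> 'g) \<Rightarrow> 'a \<Rightarrow> enat" where
  "return_time G \<xi> \<omega> = (INF n \<in> {n. n \<ge> 1 \<and> walk G \<xi> n \<omega> = \<one>\<^bsub>G\<^esub>}. enat n)"

definition local_time ::
    "('g, 'b) monoid_scheme \<Rightarrow> (nat \<Rightarrow> 'a \<Rightarrow> 'g) \<Rightarrow> nat \<Rightarrow> 'g \<Rightarrow> 'a \<Rightarrow> nat" where
  "local_time G \<xi> n x \<omega> = (\<Sum>i=0..n. of_bool (walk G \<xi> i \<omega> = x))"

text \<open>Only meant for \<open>n \<ge> 1\<close> and \<open>f 0 = 0\<close>; then the sum has finitely many nonzero terms.\<close>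

definition local_time_sum ::
    "('g, 'b) monoid_scheme \<Rightarrow> (nat \<Rightarrow> 'a \<Rightarrow> 'g) \<Rightarrow> (nat \<Rightarrow> real) \<Rightarrow> nat \<Rightarrow> 'a \<Rightarrow> real" where
  "local_time_sum G \<xi> f n \<omega> = (\<Sum>\<^sub>\<infinity>x\<in>carrier G. f (local_time G \<xi> (n - 1) x \<omega>))"

text \<open>The nonnegative integral is used because the Bochner integral of a non-integrable function
  is \<open>0\<close>. Square integrability is demanded of the limit only; not demanding it of the \<open>X n\<close> makes
  the negation of this predicate, if anything, stronger.\<close>

definition converges_in_L2 :: "'a measure \<Rightarrow> (nat \<Rightarrow> 'a \<Rightarrow> real) \<Rightarrow> bool" where
  "converges_in_L2 M X \<longleftrightarrow>
    (\<exists>Y \<in> borel_measurable M. integrable M (\<lambda>\<omega>. (Y \<omega>)\<^sup>2) \<and>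
      (\<lambda>n. \<integral>\<^sup>+ \<omega>. ennreal ((X n \<omega> - Y \<omega>)\<^sup>2) \<partial>M) \<longlonglongrightarrow> 0)"

end

theory Submission
  imports Defs
begin

text \<open>
  Write \<open>q = 1 - \<gamma>\<close> for the return probability, so that \<open>(f j)\<^sup>2 = (1 / q) ^ j\<close>: the two series are
  then the harmonic series and \<open>\<Sum> 1 / j powr (1 + \<delta>)\<close>.

  Failure of convergence in \<open>L\<^sup>2\<close> comes from rare events that carry a fixed share of the second moment.
  A site is hit \<open>j\<close> more times with probability about \<open>q ^ j\<close>, while it contributes \<open>(1 / q) ^ j\<close>
  to \<open>G\<^sub>n(f)\<^sup>2\<close>; so every level \<open>j\<close> contributes about the same amount to the second moment, even the
  levels of order \<open>n\<close>. With order \<open>n\<close> new sites and order \<open>n\<close> such levels this gives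
  \<open>E (G\<^sub>n(f)\<^sup>2; A\<^sub>n) \<ge> c n\<^sup>2\<close>, where \<open>A\<^sub>n\<close> (predicate \<open>clustering\<close>) says that some site
  is hit again at least \<open>\<epsilon> n\<close> times. But \<open>P (A\<^sub>n)\<close> is at most of order \<open>n q ^ (\<epsilon> n)\<close>
  and hence tends to \<open>0\<close>, so the square of \<open>G\<^sub>n(f) / n\<close> is not uniformly integrable and no limit in
  \<open>L\<^sup>2\<close>, whatever its value, can exist.

  The finite conditional mean of \<open>\<tau>\<close> enters only through \<open>returns_prob_ge\<close>: conditionally on being
  finite, the time of the \<open>j\<close>-th return has a mean linear in \<open>j\<close>, so by Markov's inequality
  \<open>j\<close> returns fit into a time proportional to \<open>j\<close> with probability at least \<open>q ^ j / 2\<close>.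
  That order \<open>n\<close> new sites appear is \<open>sum_prob_new_site_ge\<close>, where first visits are traded for
  last visits. The independence of a site being new and of the later returns to it is
  \<open>prob_past_future\<close>. These combine in \<open>second_moment_on_clustering_ge\<close>, and
  \<open>not_L2_convergent\<close> draws the conclusion.
\<close>

section \<open>Elementary inequalities and reindexing\<close>

lemma sum_squares_le_square_sum:
  fixes g :: "'i \<Rightarrow> real"
  assumes "finite A" "\<And>i. i \<in> A \<Longrightarrow> 0 \<le> g i"
  shows "(\<Sum>i\<in>A. (g i)\<^sup>2) \<le> (\<Sum>i\<in>A. g i)\<^sup>2"
  using assms
proof (induction A rule: finite_induct)
  case (insert a A)
  then have "0 \<le> 2 * g a * sum g A" by (simp add: sum_nonneg)
  with insert show ?case by (auto simp: power2_sum)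
qed simp

lemma geometric_sum_le_power:
  fixes q :: real
  assumes "0 < q" "q < 1"
  shows "(1 - q) * (\<Sum>j\<le>r. (1 / q) ^ j) \<le> (1 / q) ^ r"
proof (induction r)
  case 0 then show ?case using assms by simp
next
  case (Suc r)
  have "(1 - q) * (\<Sum>j\<le>Suc r. (1 / q) ^ j) \<le> (1 / q) ^ r + (1 - q) * (1 / q) ^ Suc r"
    using Suc by (simp add: distrib_left)
  also have "\<dots> = (1 / q) ^ Suc r" using assms by (simp add: field_simps)
  finally show ?case .
qed

text \<open>For a visit followed by \<open>R\<close> returns this turns the weight \<open>(1 / q) ^ R\<close> into a sum over levels \<open>j\<close>
  of \<open>(1 / q) ^ j\<close> times the indicator of \<open>j \<le> R\<close>, an event whose probability can be estimated.
  Levels above \<open>N\<close> already carry the full order of magnitude, and those up to \<open>2 * N\<close> can all be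
  reached within a time proportional to \<open>N\<close>.\<close>

lemma excursion_power_ge:
  fixes q :: real
  assumes q: "0 < q" "q < 1"
  shows "(1 - q) * (\<Sum>j\<in>{N<..2 * N}. (1 / q) ^ j * of_bool (j \<le> R)) \<le> (1 / q) ^ R * of_bool (N \<le> R)"
proof (cases "N \<le> R")
  case True
  have "(\<Sum>j\<in>{N<..2 * N}. (1 / q) ^ j * of_bool (j \<le> R)) = (\<Sum>j\<in>{N<..2 * N} \<inter> {..R}. (1 / q) ^ j)"
    by (intro sum.mono_neutral_cong_right) auto
  also have "\<dots> \<le> (\<Sum>j\<le>R. (1 / q) ^ j)"
    using q by (intro sum_mono2) auto
  finally have "(1 - q) * (\<Sum>j\<in>{N<..2 * N}. (1 / q) ^ j * of_bool (j \<le> R)) \<le> (1 - q) * (\<Sum>j\<le>R. (1 / q) ^ j)"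
    using q by (intro mult_left_mono) auto
  also have "\<dots> \<le> (1 / q) ^ R" by (rule geometric_sum_le_power[OF q])
  finally show ?thesis using True by simp
next
  case False
  then have "(\<Sum>j\<in>{N<..2 * N}. (1 / q) ^ j * of_bool (j \<le> R)) = 0"
    by (intro sum.neutral) auto
  then show ?thesis using False by simp
qed

lemma (in prob_space) indep_vars_reindex:
  assumes "inj_on h I" "indep_vars (\<lambda>_. N) X (h ` I)"
  shows "indep_vars (\<lambda>_. N) (\<lambda>i. X (h i)) I"
proof -
  define F where "F i = {X i -` A \<inter> space M | A. A \<in> sets N}" for i
  have F: "indep_sets F (h ` I)" and X: "\<forall>i\<in>h ` I. X i \<in> measurable M N"
    using assms(2) unfolding indep_vars_def2 F_def by auto
  have "indep_sets (\<lambda>i. F (h i)) I"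
  proof (rule indep_setsI)
    show "F (h i) \<subseteq> events" if "i \<in> I" for i using F that unfolding indep_sets_def by auto
    fix A J assume J: "J \<noteq> {}" "J \<subseteq> I" "finite J" and A: "\<forall>j\<in>J. A j \<in> F (h j)"
    have inj: "inj_on h J" using assms(1) J(2) by (rule inj_on_subset)
    define B where "B = A \<circ> the_inv_into J h"
    have B: "B (h j) = A j" if "j \<in> J" for j
      using the_inv_into_f_f[OF inj that] by (simp add: B_def)
    have "prob (\<Inter>j\<in>h ` J. B j) = (\<Prod>j\<in>h ` J. prob (B j))"
      using J A B by (intro indep_setsD[OF F]) auto
    then show "prob (\<Inter>j\<in>J. A j) = (\<Prod>j\<in>J. prob (A j))"
      using B by (simp add: prod.reindex[OF inj])
  qed
  then show ?thesis using X unfolding indep_vars_def2 F_def by auto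
qed

section \<open>Events determined by finitely many steps\<close>

text \<open>Index \<open>0\<close> is excluded since a walk never uses its step \<open>0\<close>.\<close>

definition determined_by :: "nat \<Rightarrow> ((nat \<Rightarrow> 'g) \<Rightarrow> 'c) \<Rightarrow> bool" where
  "determined_by k F \<longleftrightarrow> (\<forall>x y. (\<forall>i\<in>{1..k}. x i = y i) \<longrightarrow> F x = F y)"

lemma determined_byD:
  "determined_by k F \<Longrightarrow> (\<And>i. 1 \<le> i \<Longrightarrow> i \<le> k \<Longrightarrow> x i = y i) \<Longrightarrow> F x = F y"
  unfolding determined_by_def by auto

context random_walk
begin

abbreviation steps :: "'a \<Rightarrow> nat \<Rightarrow> 'g" where
  "steps \<omega> \<equiv> (\<lambda>i. \<xi> i \<omega>)"

text \<open>A walk read off from a deterministic step sequence: the steps are the coordinate projections.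
  Path statements can thus be shifted in time.\<close>

abbreviation pos :: "(nat \<Rightarrow> 'g) \<Rightarrow> nat \<Rightarrow> 'g" where
  "pos x n \<equiv> walk G (\<lambda>i y. y i) n x"

abbreviation shift :: "nat \<Rightarrow> (nat \<Rightarrow> 'g) \<Rightarrow> nat \<Rightarrow> 'g" where
  "shift k x \<equiv> (\<lambda>i. x (k + i))"

lemma walk_eq_pos: "walk G \<xi> n \<omega> = pos (steps \<omega>) n"
  by (induction n) auto

lemma step_measurable: "n \<ge> 1 \<Longrightarrow> \<xi> n \<in> measurable M (count_space (carrier G))"
  using indep_steps unfolding indep_vars_def by auto

lemma step_carrier: "\<omega> \<in> space M \<Longrightarrow> n \<ge> 1 \<Longrightarrow> \<xi> n \<omega> \<in> carrier G"
  using measurable_space[OF step_measurable] by simp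

lemma PiM_steps:
  "finite I \<Longrightarrow> PiM I (\<lambda>_. count_space (carrier G)) = count_space (PiE I (\<lambda>_. carrier G))"
  using countable_carrier by (intro count_space_PiM_finite) auto

text \<open>Finitely many steps take values in a countable set, on which every subset is measurable.\<close>

lemma measurable_of_steps:
  assumes "determined_by k F" "space N = UNIV"
  shows "(\<lambda>\<omega>. F (steps \<omega>)) \<in> measurable M N"
proof -
  have "(\<lambda>\<omega>. restrict (steps \<omega>) {1..k}) \<in> measurable M (PiM {1..k} (\<lambda>_. count_space (carrier G)))"
    by (rule measurable_restrict) (auto intro: step_measurable)
  then have Z: "(\<lambda>\<omega>. restrict (steps \<omega>) {1..k}) \<in> measurable M (count_space (PiE {1..k} (\<lambda>_. carrier G)))"
    by (simp add: PiM_steps)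
  have "F \<in> measurable (count_space (PiE {1..k} (\<lambda>_. carrier G))) N"
    using assms by auto
  from measurable_compose[OF Z this]
  have "(\<lambda>\<omega>. F (restrict (steps \<omega>) {1..k})) \<in> measurable M N" .
  moreover have "F (restrict (steps \<omega>) {1..k}) = F (steps \<omega>)" for \<omega>
    by (rule determined_byD[OF assms(1)]) auto
  ultimately show ?thesis by simp
qed

lemma event_of_steps:
  assumes "determined_by k A"
  shows "{\<omega> \<in> space M. A (steps \<omega>)} \<in> events"
  using measurable_of_steps[OF assms, of "count_space UNIV"] by (simp add: pred_def)

text \<open>Both sides are governed by the same product measure, since the steps are identically
  distributed.\<close>

lemma prob_shift:
  assumes "determined_by t B"
  shows "prob {\<omega> \<in> space M. B (shift k (steps \<omega>))} = prob {\<omega> \<in> space M. B (steps \<omega>)}"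
proof (cases "t = 0")
  case True
  then have "B x = B y" for x y by (intro determined_byD[OF assms]) auto
  then have "B (shift k (steps \<omega>)) = B (steps \<omega>)" for \<omega> by blast
  then show ?thesis by simp
next
  case False
  let ?N = "count_space (carrier G)"
  let ?P = "PiM {1..t} (\<lambda>_. ?N)"
  define S where "S = {x \<in> PiE {1..t} (\<lambda>_. carrier G). B x}"
  have law: "distr M ?P (\<lambda>\<omega>. \<lambda>i\<in>{1..t}. \<xi> (l + i) \<omega>) = PiM {1..t} (\<lambda>_. distr M ?N (\<xi> 1))" for l
  proof -
    have "indep_vars (\<lambda>_. ?N) \<xi> ((\<lambda>i. l + i) ` {1..t})"
      by (rule indep_vars_subset[OF indep_steps]) auto
    then have iv: "indep_vars (\<lambda>_. ?N) (\<lambda>i. \<xi> (l + i)) {1..t}"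
      by (rule indep_vars_reindex[rotated]) (auto simp: inj_on_def)
    have "distr M ?P (\<lambda>\<omega>. \<lambda>i\<in>{1..t}. \<xi> (l + i) \<omega>) = PiM {1..t} (\<lambda>i. distr M ?N (\<xi> (l + i)))"
      by (subst indep_vars_iff_distr_eq_PiM'[symmetric]) (use False iv step_measurable in auto)
    also have "\<dots> = PiM {1..t} (\<lambda>_. distr M ?N (\<xi> 1))"
      by (intro PiM_cong refl ident_distr_steps) auto
    finally show ?thesis .
  qed
  have meas: "(\<lambda>\<omega>. \<lambda>i\<in>{1..t}. \<xi> (l + i) \<omega>) \<in> measurable M ?P" for l
    by (rule measurable_restrict) (auto intro: step_measurable)
  have eq: "prob {\<omega> \<in> space M. B (shift l (steps \<omega>))}
      = measure (distr M ?P (\<lambda>\<omega>. \<lambda>i\<in>{1..t}. \<xi> (l + i) \<omega>)) S" for l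
  proof -
    have "B (\<lambda>i\<in>{1..t}. \<xi> (l + i) \<omega>) = B (shift l (steps \<omega>))" for \<omega>
      by (rule determined_byD[OF assms]) auto
    then have "{\<omega> \<in> space M. B (shift l (steps \<omega>))}
        = (\<lambda>\<omega>. \<lambda>i\<in>{1..t}. \<xi> (l + i) \<omega>) -` S \<inter> space M"
      by (auto simp: S_def intro: step_carrier)
    moreover have "S \<in> sets ?P" by (auto simp: PiM_steps S_def)
    ultimately show ?thesis by (simp only: measure_distr[OF meas])
  qed
  show ?thesis using eq[of k] eq[of 0] unfolding law by simp
qed

text \<open>The Markov property at a fixed time \<open>k\<close>.\<close>

lemma prob_past_future:
  assumes A: "determined_by k A" and B: "determined_by t B"
  shows "prob {\<omega> \<in> space M. A (steps \<omega>) \<and> B (shift k (steps \<omega>))}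
    = prob {\<omega> \<in> space M. A (steps \<omega>)} * prob {\<omega> \<in> space M. B (steps \<omega>)}"
proof -
  let ?N = "count_space (carrier G)"
  let ?J = "{k+1..k+t}"
  define S where "S = {x \<in> PiE {1..k} (\<lambda>_. carrier G). A x}"
  define T where "T = {x \<in> PiE ?J (\<lambda>_. carrier G). B (shift k x)}"
  have iv: "indep_var (PiM {1..k} (\<lambda>_. ?N)) (\<lambda>\<omega>. restrict (steps \<omega>) {1..k})
      (PiM ?J (\<lambda>_. ?N)) (\<lambda>\<omega>. restrict (steps \<omega>) ?J)"
    by (rule indep_var_restrict[OF indep_steps]) auto
  have ST: "S \<in> sets (PiM {1..k} (\<lambda>_. ?N))" "T \<in> sets (PiM ?J (\<lambda>_. ?N))"
    by (auto simp: PiM_steps S_def T_def)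
  have a: "A (restrict (steps \<omega>) {1..k}) = A (steps \<omega>)" for \<omega>
    by (rule determined_byD[OF A]) auto
  have b: "B (shift k (restrict (steps \<omega>) ?J)) = B (shift k (steps \<omega>))" for \<omega>
    by (rule determined_byD[OF B]) auto
  have Si: "restrict (steps \<omega>) {1..k} \<in> S \<longleftrightarrow> A (steps \<omega>)"
    and Ti: "restrict (steps \<omega>) ?J \<in> T \<longleftrightarrow> B (shift k (steps \<omega>))" if "\<omega> \<in> space M" for \<omega>
    unfolding S_def T_def using a[of \<omega>] b[of \<omega>] that by (auto intro: step_carrier)
  have "prob {\<omega> \<in> space M. A (steps \<omega>) \<and> B (shift k (steps \<omega>))}
     = prob ((\<lambda>\<omega>. (restrict (steps \<omega>) {1..k}, restrict (steps \<omega>) ?J)) -` (S \<times> T) \<inter> space M)"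
    using Si Ti by (intro arg_cong[where f = prob]) blast
  also have "\<dots> = prob ((\<lambda>\<omega>. restrict (steps \<omega>) {1..k}) -` S \<inter> space M)
      * prob ((\<lambda>\<omega>. restrict (steps \<omega>) ?J) -` T \<inter> space M)"
    by (rule indep_varD[OF iv ST])
  also have "(\<lambda>\<omega>. restrict (steps \<omega>) {1..k}) -` S \<inter> space M = {\<omega> \<in> space M. A (steps \<omega>)}"
    using Si by blast
  also have "(\<lambda>\<omega>. restrict (steps \<omega>) ?J) -` T \<inter> space M = {\<omega> \<in> space M. B (shift k (steps \<omega>))}"
    using Ti by blast
  finally show ?thesis by (simp add: prob_shift[OF B])
qed

section \<open>Returns and new sites along a path\<close>

definition returns :: "nat \<Rightarrow> (nat \<Rightarrow> 'g) \<Rightarrow> nat" where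
  "returns t x = card {i \<in> {1..t}. pos x i = \<one>}"

definition first_return :: "nat \<Rightarrow> (nat \<Rightarrow> 'g) \<Rightarrow> bool" where
  "first_return s x \<longleftrightarrow> s \<ge> 1 \<and> pos x s = \<one> \<and> (\<forall>i\<in>{1..<s}. pos x i \<noteq> \<one>)"

definition new_site :: "nat \<Rightarrow> (nat \<Rightarrow> 'g) \<Rightarrow> bool" where
  "new_site k x \<longleftrightarrow> (\<forall>i<k. pos x i \<noteq> pos x k)"

lemma pos_cong: "(\<And>i. 1 \<le> i \<Longrightarrow> i \<le> n \<Longrightarrow> x i = y i) \<Longrightarrow> pos x n = pos y n"
  by (induction n) auto

lemma determined_by_returns: "determined_by t (returns t)"
  unfolding determined_by_def returns_def
proof (intro allI impI)
  fix x y :: "nat \<Rightarrow> 'g" assume "\<forall>i\<in>{1..t}. x i = y i"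
  then have "pos x i = pos y i" if "i \<le> t" for i using that by (intro pos_cong) auto
  then have "{i \<in> {1..t}. pos x i = \<one>} = {i \<in> {1..t}. pos y i = \<one>}" by auto
  then show "card {i \<in> {1..t}. pos x i = \<one>} = card {i \<in> {1..t}. pos y i = \<one>}" by simp
qed

lemma determined_by_returns_ge: "determined_by t (\<lambda>x. j \<le> returns t x)"
  using determined_by_returns unfolding determined_by_def by metis

lemma determined_by_first_return: "determined_by s (first_return s)"
  unfolding determined_by_def first_return_def
proof (intro allI impI)
  fix x y :: "nat \<Rightarrow> 'g" assume "\<forall>i\<in>{1..s}. x i = y i"
  then have "pos x i = pos y i" if "i \<le> s" for i using that by (intro pos_cong) auto
  then show "(1 \<le> s \<and> pos x s = \<one> \<and> (\<forall>i\<in>{1..<s}. pos x i \<noteq> \<one>)) =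
    (1 \<le> s \<and> pos y s = \<one> \<and> (\<forall>i\<in>{1..<s}. pos y i \<noteq> \<one>))" by auto
qed

lemma determined_by_new_site: "determined_by k (new_site k)"
  unfolding determined_by_def new_site_def
proof (intro allI impI)
  fix x y :: "nat \<Rightarrow> 'g" assume "\<forall>i\<in>{1..k}. x i = y i"
  then have "pos x i = pos y i" if "i \<le> k" for i using that by (intro pos_cong) auto
  then show "(\<forall>i<k. pos x i \<noteq> pos x k) = (\<forall>i<k. pos y i \<noteq> pos y k)" by auto
qed

definition carrier_valued :: "(nat \<Rightarrow> 'g) \<Rightarrow> bool" where
  "carrier_valued x \<longleftrightarrow> (\<forall>i\<ge>1. x i \<in> carrier G)"

lemma carrier_valued_steps: "\<omega> \<in> space M \<Longrightarrow> carrier_valued (steps \<omega>)"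
  by (simp add: carrier_valued_def step_carrier)

lemma carrier_valued_shift: "carrier_valued x \<Longrightarrow> carrier_valued (shift k x)"
  by (simp add: carrier_valued_def)

lemma pos_carrier: "carrier_valued x \<Longrightarrow> pos x n \<in> carrier G"
  by (induction n) (auto simp: carrier_valued_def)

lemma pos_shift_carrier: "carrier_valued x \<Longrightarrow> pos (shift k x) i \<in> carrier G"
  by (rule pos_carrier[OF carrier_valued_shift])

lemma pos_add:
  assumes "carrier_valued x"
  shows "pos x (k + i) = pos x k \<otimes> pos (shift k x) i"
proof (induction i)
  case 0 then show ?case using pos_carrier[OF assms] by simp
next
  case (Suc i)
  have "x (Suc (k + i)) \<in> carrier G" using assms by (simp add: carrier_valued_def)
  then show ?case
    using Suc m_assoc[OF pos_carrier[OF assms] pos_shift_carrier[OF assms]] by simp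
qed

lemma pos_add_eq_iff:
  assumes "carrier_valued x"
  shows "pos x (k + i) = pos x k \<longleftrightarrow> pos (shift k x) i = \<one>"
  unfolding pos_add[OF assms]
  by (rule l_cancel_one[OF pos_carrier[OF assms] pos_shift_carrier[OF assms]])

lemma first_return_unique: "first_return s x \<Longrightarrow> first_return s' x \<Longrightarrow> s = s'"
  unfolding first_return_def
  by (metis atLeastLessThan_iff linorder_neqE_nat)

lemma first_return_exists:
  assumes "n \<ge> 1" "pos x n = \<one>"
  shows "\<exists>s\<le>n. first_return s x"
proof -
  define s where "s = (LEAST s. s \<ge> 1 \<and> pos x s = \<one>)"
  have "s \<ge> 1 \<and> pos x s = \<one>" unfolding s_def by (rule LeastI[of _ n]) (use assms in auto)
  moreover have "\<not> (i \<ge> 1 \<and> pos x i = \<one>)" if "i < s" for i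
    using not_less_Least that unfolding s_def by blast
  moreover have "s \<le> n" unfolding s_def by (rule Least_le) (use assms in auto)
  ultimately show ?thesis unfolding first_return_def by auto
qed

lemma returns_first_return:
  assumes "carrier_valued x" "first_return s x" "s \<le> t"
  shows "returns t x = Suc (returns (t - s) (shift s x))"
proof -
  have "{i \<in> {1..t}. pos x i = \<one>} = insert s ((\<lambda>i. s + i) ` {i \<in> {1..t - s}. pos (shift s x) i = \<one>})"
  proof (intro Set.set_eqI iffI)
    fix i assume i: "i \<in> {i \<in> {1..t}. pos x i = \<one>}"
    show "i \<in> insert s ((\<lambda>i. s + i) ` {i \<in> {1..t - s}. pos (shift s x) i = \<one>})"
    proof (cases "i \<le> s")
      case True
      then show ?thesis using i assms(2) unfolding first_return_def by force
    next
      case False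
      then obtain d where d: "i = s + d" "d \<ge> 1" using less_imp_Suc_add[of s i] by force
      have "pos (shift s x) d = \<one>"
        using i assms(2) d pos_add_eq_iff[OF assms(1), of s d] by (auto simp: first_return_def)
      then show ?thesis using i d by auto
    qed
  next
    fix i assume "i \<in> insert s ((\<lambda>i. s + i) ` {i \<in> {1..t - s}. pos (shift s x) i = \<one>})"
    then show "i \<in> {i \<in> {1..t}. pos x i = \<one>}"
      using assms pos_add_eq_iff[OF assms(1), of s] by (auto simp: first_return_def)
  qed
  moreover have "s \<notin> (\<lambda>i. s + i) ` {i \<in> {1..t - s}. pos (shift s x) i = \<one>}" by auto
  ultimately show ?thesis
    unfolding returns_def by (simp add: card_image)
qed

lemma returns_ge_Suc_iff:
  assumes "carrier_valued x"
  shows "Suc j \<le> returns t x \<longleftrightarrow> (\<exists>s\<in>{1..t}. first_return s x \<and> j \<le> returns (t - s) (shift s x))"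
proof
  assume *: "Suc j \<le> returns t x"
  then have "{i \<in> {1..t}. pos x i = \<one>} \<noteq> {}" unfolding returns_def by (metis card.empty Suc_n_not_le_n le_0_eq Zero_not_Suc)
  then obtain i where "1 \<le> i" "i \<le> t" "pos x i = \<one>" by auto
  then obtain s where s: "s \<le> t" "first_return s x"
    using first_return_exists by (meson order_trans)
  then show "\<exists>s\<in>{1..t}. first_return s x \<and> j \<le> returns (t - s) (shift s x)"
    using * returns_first_return[OF assms s(2,1)] by (auto simp: first_return_def)
next
  assume "\<exists>s\<in>{1..t}. first_return s x \<and> j \<le> returns (t - s) (shift s x)"
  then show "Suc j \<le> returns t x" using returns_first_return[OF assms] by auto
qed

section \<open>Probability of many returns\<close>

definition returns_prob :: "nat \<Rightarrow> nat \<Rightarrow> real" where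
  "returns_prob j t = prob {\<omega> \<in> space M. j \<le> returns t (steps \<omega>)}"

definition \<phi> :: "nat \<Rightarrow> real" where
  "\<phi> s = prob {\<omega> \<in> space M. first_return s (steps \<omega>)}"

definition q :: real where "q = 1 - escape_prob G M \<xi>"

lemma returns_prob_0: "returns_prob 0 t = 1" by (simp add: returns_prob_def prob_space)

text \<open>Renewal equation, from splitting at the first return.\<close>

lemma returns_prob_Suc: "returns_prob (Suc j) t = (\<Sum>s=1..t. \<phi> s * returns_prob j (t - s))"
proof -
  define E where "E s = {\<omega> \<in> space M. first_return s (steps \<omega>) \<and> j \<le> returns (t - s) (shift s (steps \<omega>))}" for s
  have "{\<omega> \<in> space M. Suc j \<le> returns t (steps \<omega>)} = (\<Union>s\<in>{1..t}. E s)"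
    using returns_ge_Suc_iff[OF carrier_valued_steps] unfolding E_def by blast
  then have "returns_prob (Suc j) t = prob (\<Union>s\<in>{1..t}. E s)" by (simp add: returns_prob_def)
  also have "\<dots> = (\<Sum>s=1..t. prob (E s))"
  proof (rule finite_measure_finite_Union)
    show "disjoint_family_on E {1..t}"
      unfolding disjoint_family_on_def E_def using first_return_unique by blast
    have "determined_by t (\<lambda>x. first_return s x \<and> j \<le> returns (t - s) (shift s x))"
      if "s \<le> t" for s
    proof (unfold determined_by_def, intro allI impI)
      fix x y :: "nat \<Rightarrow> 'g" assume xy: "\<forall>i\<in>{1..t}. x i = y i"
      have "first_return s x = first_return s y"
        by (rule determined_byD[OF determined_by_first_return]) (use xy that in auto)
      moreover have "returns (t - s) (shift s x) = returns (t - s) (shift s y)"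
        by (rule determined_byD[OF determined_by_returns]) (use xy that in auto)
      ultimately show "(first_return s x \<and> j \<le> returns (t - s) (shift s x)) =
        (first_return s y \<and> j \<le> returns (t - s) (shift s y))" by simp
    qed
    from event_of_steps[OF this] show "E ` {1..t} \<subseteq> events" unfolding E_def by auto
  qed auto
  also have "\<dots> = (\<Sum>s=1..t. \<phi> s * returns_prob j (t - s))"
    unfolding E_def \<phi>_def returns_prob_def
    using prob_past_future[OF determined_by_first_return determined_by_returns_ge] by simp
  finally show ?thesis .
qed

lemma first_return_0 [simp]: "\<not> first_return 0 x"
  by (simp add: first_return_def)

lemma \<phi>_0 [simp]: "\<phi> 0 = 0"
  by (simp add: \<phi>_def)

lemma \<phi>_nonneg [simp]: "0 \<le> \<phi> s"
  by (simp add: \<phi>_def)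

lemma event_first_return: "{\<omega> \<in> space M. first_return s (steps \<omega>)} \<in> events"
  by (rule event_of_steps[OF determined_by_first_return])

lemma returning_eq_UN:
  "{\<omega> \<in> space M. \<exists>n\<ge>1. walk G \<xi> n \<omega> = \<one>} = (\<Union>s. {\<omega> \<in> space M. first_return s (steps \<omega>)})"
  using first_return_exists unfolding walk_eq_pos first_return_def by blast

lemma event_returning: "{\<omega> \<in> space M. \<exists>n\<ge>1. walk G \<xi> n \<omega> = \<one>} \<in> events"
  unfolding returning_eq_UN using event_first_return by blast

lemma q_eq: "q = prob {\<omega> \<in> space M. \<exists>n\<ge>1. walk G \<xi> n \<omega> = \<one>}"
proof -
  have "{\<omega> \<in> space M. \<forall>n\<ge>1. walk G \<xi> n \<omega> \<noteq> \<one>} = space M - {\<omega> \<in> space M. \<exists>n\<ge>1. walk G \<xi> n \<omega> = \<one>}"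
    by blast
  then show ?thesis
    unfolding q_def escape_prob_def by (simp only: prob_compl[OF event_returning])
qed

lemma \<phi>_sums: "\<phi> sums q"
  unfolding q_eq returning_eq_UN \<phi>_def
proof (rule finite_measure_UNION)
  show "disjoint_family (\<lambda>s. {\<omega> \<in> space M. first_return s (steps \<omega>)})"
    unfolding disjoint_family_on_def using first_return_unique by blast
qed (use event_first_return in blast)

lemma q_nonneg: "0 \<le> q"
  unfolding q_eq by simp

lemma sum_\<phi>_le: "finite A \<Longrightarrow> sum \<phi> A \<le> q"
  using sum_le_suminf[OF sums_summable[OF \<phi>_sums], of A] sums_unique[OF \<phi>_sums] by simp

lemma returns_prob_le: "returns_prob j t \<le> q ^ j"
proof (induction j arbitrary: t)
  case 0 then show ?case by (simp add: returns_prob_0)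
next
  case (Suc j)
  have "returns_prob (Suc j) t \<le> (\<Sum>s=1..t. \<phi> s * q ^ j)"
    unfolding returns_prob_Suc by (intro sum_mono mult_left_mono Suc \<phi>_nonneg)
  also have "\<dots> \<le> q * q ^ j"
    unfolding sum_distrib_right[symmetric] using q_nonneg
    by (intro mult_right_mono sum_\<phi>_le) auto
  finally show ?case by simp
qed

lemma returns_mono: "t \<le> t' \<Longrightarrow> returns t x \<le> returns t' x"
  unfolding returns_def by (intro card_mono) auto

lemma event_returns_ge: "{\<omega> \<in> space M. j \<le> returns t (steps \<omega>)} \<in> events"
  by (rule event_of_steps[OF determined_by_returns_ge])

lemma returns_prob_mono: "t \<le> t' \<Longrightarrow> returns_prob j t \<le> returns_prob j t'"
  unfolding returns_prob_def
  by (intro finite_measure_mono event_returns_ge)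
     (auto intro: order_trans[OF _ returns_mono])

text \<open>The summand is \<open>P (t < \<tau> < \<infinity>)\<close>, so this is the tail formula for the expectation of \<open>\<tau>\<close>
  on \<open>\<tau> < \<infinity>\<close>.\<close>

lemma sum_return_tail_le:
  assumes "\<And>L. (\<Sum>s<L. real s * \<phi> s) \<le> \<mu>"
  shows "(\<Sum>t<N. q - (\<Sum>s=1..t. \<phi> s)) \<le> \<mu>"
proof (rule LIMSEQ_le_const2)
  have "(\<lambda>L. \<Sum>s<L. \<phi> s) \<longlonglongrightarrow> q" using \<phi>_sums by (simp add: sums_def)
  then show "(\<lambda>L. \<Sum>t<N. (\<Sum>s<L. \<phi> s) - (\<Sum>s=1..t. \<phi> s)) \<longlonglongrightarrow> (\<Sum>t<N. q - (\<Sum>s=1..t. \<phi> s))"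
    by (intro tendsto_intros)
  show "\<exists>L0. \<forall>L\<ge>L0. (\<Sum>t<N. (\<Sum>s<L. \<phi> s) - (\<Sum>s=1..t. \<phi> s)) \<le> \<mu>"
  proof (intro exI[of _ N] allI impI)
    fix L assume L: "N \<le> L"
    have "(\<Sum>s<L. \<phi> s) - (\<Sum>s=1..t. \<phi> s) = (\<Sum>s<L. of_bool (t < s) * \<phi> s)" if "t < N" for t
    proof -
      have "(\<Sum>s=1..t. \<phi> s) = (\<Sum>s<L. of_bool (s \<le> t) * \<phi> s)"
        using that L by (intro sum.mono_neutral_cong_left) (auto simp: not_le Suc_le_eq)
      then show ?thesis
        by (simp add: sum_subtractf[symmetric] of_bool_def) (intro sum.cong, auto)
    qed
    then have "(\<Sum>t<N. (\<Sum>s<L. \<phi> s) - (\<Sum>s=1..t. \<phi> s)) = (\<Sum>t<N. \<Sum>s<L. of_bool (t < s) * \<phi> s)"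
      by simp
    also have "\<dots> = (\<Sum>s<L. (\<Sum>t<N. of_bool (t < s)) * \<phi> s)"
      unfolding sum_distrib_right by (rule sum.swap)
    also have "\<dots> \<le> (\<Sum>s<L. real s * \<phi> s)"
    proof (intro sum_mono mult_right_mono \<phi>_nonneg)
      fix s
      have "card ({..<N} \<inter> {t. t < s}) \<le> card {..<s}" by (intro card_mono) auto
      then show "(\<Sum>t<N. of_bool (t < s)) \<le> real s"
        by (simp add: sum_of_bool_eq)
    qed
    also have "\<dots> \<le> \<mu>" by (rule assms)
    finally show "(\<Sum>t<N. (\<Sum>s<L. \<phi> s) - (\<Sum>s=1..t. \<phi> s)) \<le> \<mu>" .
  qed
qed

text \<open>The deficit \<open>q ^ j - returns_prob j t\<close> is the probability that the \<open>j\<close>-th return time is finite but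
  exceeds \<open>t\<close>; summed over \<open>t\<close> it gives the expectation of that time, which is additive over the
  \<open>j\<close> excursions. The constant \<open>m\<close> plays the role of \<open>E (\<tau> | \<tau> < \<infinity>)\<close>. Working with the deficits
  up to a fixed \<open>N\<close> keeps the induction within finite sums.\<close>

lemma sum_deficit_le:
  assumes "\<And>L. (\<Sum>s<L. real s * \<phi> s) \<le> q * m"
  shows "(\<Sum>t<N. q ^ j - returns_prob j t) \<le> real j * q ^ j * m"
proof (induction j)
  case 0 then show ?case by (simp add: returns_prob_0)
next
  case (Suc j)
  let ?v = "\<lambda>t. q ^ j - returns_prob j t"
  have v: "0 \<le> ?v t" for t using returns_prob_le[of j t] by simp
  have step: "q ^ Suc j - returns_prob (Suc j) t
      = q ^ j * (q - (\<Sum>s=1..t. \<phi> s)) + (\<Sum>s=1..t. \<phi> s * ?v (t - s))" for t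
    by (simp add: returns_prob_Suc algebra_simps sum_subtractf sum_distrib_left)
  have "(\<Sum>t<N. \<Sum>s=1..t. \<phi> s * ?v (t - s)) = (\<Sum>t<N. \<Sum>s<N. \<phi> s * (of_bool (s \<le> t) * ?v (t - s)))"
    by (intro sum.cong refl sum.mono_neutral_cong_left) (auto simp: not_le Suc_le_eq)
  also have "\<dots> = (\<Sum>s<N. \<phi> s * (\<Sum>t<N. of_bool (s \<le> t) * ?v (t - s)))"
    unfolding sum_distrib_left by (rule sum.swap)
  also have "\<dots> \<le> (\<Sum>s<N. \<phi> s * (\<Sum>t<N. ?v t))"
  proof (rule sum_mono, rule mult_left_mono[OF _ \<phi>_nonneg])
    fix s
    have inj: "inj_on (\<lambda>t. t - s) {s..<N}" by (auto simp: inj_on_def)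
    have "(\<Sum>t<N. of_bool (s \<le> t) * ?v (t - s)) = (\<Sum>t\<in>{s..<N}. ?v (t - s))"
      by (intro sum.mono_neutral_cong_right) auto
    also have "\<dots> = sum ?v ((\<lambda>t. t - s) ` {s..<N})"
      by (simp add: sum.reindex[OF inj])
    also have "\<dots> \<le> (\<Sum>t<N. ?v t)"
      by (intro sum_mono2 v) auto
    finally show "(\<Sum>t<N. of_bool (s \<le> t) * ?v (t - s)) \<le> (\<Sum>t<N. ?v t)" .
  qed
  also have "\<dots> = (\<Sum>s<N. \<phi> s) * (\<Sum>t<N. ?v t)" by (simp add: sum_distrib_right)
  also have "\<dots> \<le> q * (\<Sum>t<N. ?v t)"
    by (intro mult_right_mono sum_\<phi>_le sum_nonneg v) auto
  also have "\<dots> \<le> q * (real j * q ^ j * m)"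
    by (intro mult_left_mono Suc q_nonneg)
  finally have *: "(\<Sum>t<N. \<Sum>s=1..t. \<phi> s * ?v (t - s)) \<le> q * (real j * q ^ j * m)" .
  have "(\<Sum>t<N. q ^ Suc j - returns_prob (Suc j) t)
      = q ^ j * (\<Sum>t<N. q - (\<Sum>s=1..t. \<phi> s)) + (\<Sum>t<N. \<Sum>s=1..t. \<phi> s * ?v (t - s))"
    unfolding step sum.distrib sum_distrib_left ..
  also have "\<dots> \<le> q ^ j * (q * m) + q * (real j * q ^ j * m)"
    using q_nonneg by (intro add_mono * mult_left_mono sum_return_tail_le assms) auto
  also have "\<dots> = real (Suc j) * q ^ Suc j * m" by (simp add: algebra_simps)
  finally show ?case .
qed

text \<open>Markov's inequality for the \<open>j\<close>-th return time: as the deficit decreases in \<open>t\<close>, it is at most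
  its average over the times up to \<open>t\<close>.\<close>

lemma returns_prob_ge:
  assumes "\<And>L. (\<Sum>s<L. real s * \<phi> s) \<le> q * m" and t: "2 * real j * m \<le> real t"
  shows "q ^ j / 2 \<le> returns_prob j t"
proof -
  have "real (Suc t) * (q ^ j - returns_prob j t) = (\<Sum>r<Suc t. q ^ j - returns_prob j t)" by simp
  also have "\<dots> \<le> (\<Sum>r<Suc t. q ^ j - returns_prob j r)"
    by (intro sum_mono diff_left_mono returns_prob_mono) auto
  also have "\<dots> \<le> real j * m * q ^ j" using sum_deficit_le[OF assms(1), of j "Suc t"] by (simp add: mult_ac)
  also have "\<dots> \<le> real (Suc t) / 2 * q ^ j"
    using t q_nonneg by (intro mult_right_mono) auto
  finally have "real (Suc t) * (q ^ j - returns_prob j t) \<le> real (Suc t) * (q ^ j / 2)" by simp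
  then have "q ^ j - returns_prob j t \<le> q ^ j / 2" by (subst (asm) mult_le_cancel_left_pos) auto
  then show ?thesis by simp
qed

section \<open>Number of new sites\<close>

lemma determined_by_shift:
  assumes "determined_by t B"
  shows "determined_by (k + t) (\<lambda>x. B (shift k x))"
  unfolding determined_by_def by (auto intro!: determined_byD[OF assms])

text \<open>Times without later return are last visits, hence injectively labelled by their sites, and each
  of these sites also has a first visit.\<close>

lemma card_new_sites_ge:
  assumes "carrier_valued x"
  shows "card {k. k < n \<and> returns n (shift k x) = 0} \<le> card {k. k < n \<and> new_site k x}"
proof -
  let ?L = "{k. k < n \<and> returns n (shift k x) = 0}" and ?F = "{k. k < n \<and> new_site k x}"
  have last: "pos x i \<noteq> pos x k" if "k \<in> ?L" "k < i" "i < n" for i k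
  proof
    assume eq: "pos x i = pos x k"
    have "pos (shift k x) (i - k) = \<one>"
      using pos_add_eq_iff[OF assms, of k "i - k"] eq that by simp
    then have "i - k \<in> {i \<in> {1..n}. pos (shift k x) i = \<one>}" using that by auto
    then show False using that(1) unfolding returns_def by (auto simp: card_eq_0_iff)
  qed
  then have "inj_on (pos x) ?L"
    by (intro linorder_inj_onI') (metis (no_types, lifting) mem_Collect_eq)
  then have "card ?L = card (pos x ` ?L)" by (simp add: card_image)
  also have "pos x ` ?L \<subseteq> pos x ` ?F"
  proof
    fix y assume "y \<in> pos x ` ?L"
    then obtain k where k: "k < n" "pos x k = y" by auto
    define l where "l = (LEAST l. pos x l = y)"
    have "pos x l = y" unfolding l_def by (rule LeastI, rule k(2))
    moreover have "l \<le> k" unfolding l_def by (rule Least_le, rule k(2))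
    moreover have "pos x i \<noteq> y" if "i < l" for i
      using not_less_Least[of i "\<lambda>l. pos x l = y"] that unfolding l_def by simp
    ultimately show "y \<in> pos x ` ?F" using k unfolding new_site_def by force
  qed
  then have "card (pos x ` ?L) \<le> card (pos x ` ?F)" by (intro card_mono) auto
  also have "\<dots> \<le> card ?F" by (intro card_image_le) auto
  finally show ?thesis .
qed

text \<open>By shift invariance each time is a last visit with probability at least \<open>\<gamma> = 1 - q\<close>, whereas a
  direct bound on first visits would call for time reversal.\<close>

lemma sum_prob_new_site_ge: "real n * (1 - q) \<le> (\<Sum>k<n. prob {\<omega> \<in> space M. new_site k (steps \<omega>)})"
proof -
  define F where "F k = {\<omega> \<in> space M. new_site k (steps \<omega>)}" for k
  define L where "L k = {\<omega> \<in> space M. returns n (shift k (steps \<omega>)) = 0}" for k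
  have d0: "determined_by n (\<lambda>x. returns n x = 0)"
    using determined_by_returns unfolding determined_by_def by metis
  have [measurable]: "F k \<in> events" "L k \<in> events" for k
    unfolding F_def L_def
    using event_of_steps[OF determined_by_new_site] event_of_steps[OF determined_by_shift[OF d0]] by auto
  have "prob (L k) \<ge> 1 - q" for k
  proof -
    have "prob (L k) = prob {\<omega> \<in> space M. returns n (steps \<omega>) = 0}"
      unfolding L_def by (rule prob_shift[OF d0])
    also have "{\<omega> \<in> space M. returns n (steps \<omega>) = 0} = space M - {\<omega> \<in> space M. 1 \<le> returns n (steps \<omega>)}"
      by auto
    also have "prob \<dots> = 1 - returns_prob 1 n"
      unfolding returns_prob_def by (intro prob_compl event_returns_ge)
    finally show ?thesis using returns_prob_le[of 1 n] by simp
  qed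
  then have "real n * (1 - q) \<le> (\<Sum>k<n. prob (L k))"
    using sum_mono[of "{..<n}" "\<lambda>_. 1 - q" "\<lambda>k. prob (L k)"] by simp
  also have "\<dots> = expectation (\<lambda>\<omega>. \<Sum>k<n. indicator (L k) \<omega>)"
    by (subst Bochner_Integration.integral_sum)
       (auto simp: Int_absorb2 sets.sets_into_space emeasure_eq_measure intro!: integrable_real_indicator)
  also have "\<dots> \<le> expectation (\<lambda>\<omega>. \<Sum>k<n. indicator (F k) \<omega>)"
  proof (rule integral_mono)
    fix \<omega> assume \<omega>: "\<omega> \<in> space M"
    have "(\<Sum>k<n. indicator (L k) \<omega>) = real (card {k. k < n \<and> returns n (shift k (steps \<omega>)) = 0})"
      using \<omega> by (simp add: L_def indicator_def sum_of_bool_eq Int_def)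
    moreover have "(\<Sum>k<n. indicator (F k) \<omega>) = real (card {k. k < n \<and> new_site k (steps \<omega>)})"
      using \<omega> by (simp add: F_def indicator_def sum_of_bool_eq Int_def)
    ultimately show "(\<Sum>k<n. indicator (L k) \<omega>) \<le> (\<Sum>k<n. indicator (F k) \<omega> :: real)"
      using card_new_sites_ge[OF carrier_valued_steps[OF \<omega>]] by simp
  qed (auto intro!: Bochner_Integration.integrable_sum integrable_real_indicator simp: emeasure_eq_measure)
  also have "\<dots> = (\<Sum>k<n. prob (F k))"
    by (subst Bochner_Integration.integral_sum)
       (auto simp: Int_absorb2 sets.sets_into_space emeasure_eq_measure intro!: integrable_real_indicator)
  finally show ?thesis unfolding F_def .
qed

section \<open>The first moment of the return time\<close>

lemma return_time_finite_iff: "return_time G \<xi> \<omega> < \<infinity> \<longleftrightarrow> (\<exists>n\<ge>1. walk G \<xi> n \<omega> = \<one>)"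
proof
  assume *: "return_time G \<xi> \<omega> < \<infinity>"
  show "\<exists>n\<ge>1. walk G \<xi> n \<omega> = \<one>"
  proof (rule ccontr)
    assume "\<not> ?thesis"
    then have "{n. n \<ge> 1 \<and> walk G \<xi> n \<omega> = \<one>} = {}" by auto
    then show False using * by (simp only: return_time_def) (simp add: top_enat_def)
  qed
next
  assume "\<exists>n\<ge>1. walk G \<xi> n \<omega> = \<one>"
  then obtain n where "n \<ge> 1" "walk G \<xi> n \<omega> = \<one>" by auto
  then have "return_time G \<xi> \<omega> \<le> enat n" unfolding return_time_def by (intro INF_lower) auto
  then show "return_time G \<xi> \<omega> < \<infinity>" by (rule order.strict_trans1) simp
qed

lemma return_time_ge:
  assumes "first_return s (steps \<omega>)"
  shows "enat s \<le> return_time G \<xi> \<omega>"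
  unfolding return_time_def
proof (rule INF_greatest)
  fix n assume "n \<in> {n. n \<ge> 1 \<and> walk G \<xi> n \<omega> = \<one>}"
  then obtain s' where "s' \<le> n" "first_return s' (steps \<omega>)"
    using first_return_exists[of n "steps \<omega>"] by (auto simp: walk_eq_pos)
  then show "enat s \<le> enat n" using first_return_unique[OF assms] by simp
qed

text \<open>The conditional expectation of \<open>\<tau>\<close> is compared with that of the simple functions
  \<open>\<Sum>s<L. s * indicator (\<tau> = s)\<close>; then \<open>m\<close> can be \<open>E (\<tau> | \<tau> < \<infinity>)\<close> itself because
  \<open>q = P (\<tau> < \<infinity>)\<close>.\<close>

lemma first_moment_bound:
  defines "R \<equiv> {\<omega> \<in> space M. return_time G \<xi> \<omega> < \<infinity>}"
  assumes "prob R > 0"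
    and "(\<integral>\<^sup>+ \<omega>. ennreal_of_enat (return_time G \<xi> \<omega>) \<partial>uniform_measure M R) < \<infinity>"
  shows "\<exists>m\<ge>0. \<forall>L. (\<Sum>s<L. real s * \<phi> s) \<le> q * m"
proof -
  define F where "F s = {\<omega> \<in> space M. first_return s (steps \<omega>)}" for s
  have F [measurable]: "F s \<in> events" for s unfolding F_def by (rule event_first_return)
  have R: "R = {\<omega> \<in> space M. \<exists>n\<ge>1. walk G \<xi> n \<omega> = \<one>}"
    unfolding R_def return_time_finite_iff ..
  have qR: "q = prob R" unfolding q_eq R ..
  have [measurable]: "R \<in> events" unfolding R by (rule event_returning)
  have FR: "F s \<subseteq> R" for s
    unfolding F_def R walk_eq_pos first_return_def by blast
  let ?I = "\<integral>\<^sup>+ \<omega>. ennreal_of_enat (return_time G \<xi> \<omega>) \<partial>uniform_measure M R"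
  define m where "m = enn2real ?I"
  have I: "?I = ennreal m" using assms(3) unfolding m_def by simp
  have "(\<Sum>s<L. real s * \<phi> s) \<le> q * m" for L
  proof -
    define g where "g \<omega> = (\<Sum>s<L. real s * indicator (F s) \<omega>)" for \<omega>
    have [measurable]: "g \<in> borel_measurable M" unfolding g_def by measurable
    have le: "ennreal (g \<omega>) \<le> ennreal_of_enat (return_time G \<xi> \<omega>)" for \<omega>
    proof (cases "\<exists>s<L. \<omega> \<in> F s")
      case True
      then obtain s where s: "s < L" "\<omega> \<in> F s" by auto
      have "g \<omega> = (\<Sum>r<L. if r = s then real s else 0)"
        unfolding g_def using s first_return_unique
        by (intro sum.cong refl) (auto simp: F_def indicator_def)
      also have "\<dots> = real s" using s by simp
      finally have "ennreal (g \<omega>) = ennreal_of_enat (enat s)" by (simp add: ennreal_of_nat_eq_real_of_nat)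
      also have "\<dots> \<le> ennreal_of_enat (return_time G \<xi> \<omega>)"
        using s return_time_ge by (simp add: F_def del: ennreal_of_enat_enat)
      finally show ?thesis .
    next
      case False
      then have "g \<omega> = 0" unfolding g_def by (intro sum.neutral) auto
      then show ?thesis by simp
    qed
    have "(\<integral>\<^sup>+ \<omega>. ennreal (g \<omega>) \<partial>uniform_measure M R) \<le> ennreal m"
      unfolding I[symmetric] by (intro nn_integral_mono le)
    also have "(\<integral>\<^sup>+ \<omega>. ennreal (g \<omega>) \<partial>uniform_measure M R)
        = (\<integral>\<^sup>+ \<omega>. ennreal (g \<omega>) * indicator R \<omega> \<partial>M) / emeasure M R"
      by (rule nn_integral_uniform_measure) measurable
    also have "(\<integral>\<^sup>+ \<omega>. ennreal (g \<omega>) * indicator R \<omega> \<partial>M) = (\<integral>\<^sup>+ \<omega>. ennreal (g \<omega>) \<partial>M)"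
    proof (rule nn_integral_cong)
      fix \<omega>
      have "g \<omega> = 0" if "\<omega> \<notin> R"
        unfolding g_def using FR that by (intro sum.neutral) (auto simp: indicator_def)
      then show "ennreal (g \<omega>) * indicator R \<omega> = ennreal (g \<omega>)"
        by (cases "\<omega> \<in> R") auto
    qed
    also have "\<dots> = ennreal (expectation g)"
    proof (rule nn_integral_eq_integral)
      show "integrable M g" unfolding g_def
        by (intro Bochner_Integration.integrable_sum integrable_mult_right integrable_real_indicator)
           (auto simp: emeasure_eq_measure)
    qed (auto simp: g_def intro!: sum_nonneg)
    also have "expectation g = (\<Sum>s<L. real s * \<phi> s)"
      unfolding g_def \<phi>_def F_def[symmetric]
      by (subst Bochner_Integration.integral_sum)
       (auto simp: Int_absorb2 sets.sets_into_space emeasure_eq_measure intro!: integrable_real_indicator)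
    finally have "ennreal (\<Sum>s<L. real s * \<phi> s) / ennreal (prob R) \<le> ennreal m"
      by (simp add: emeasure_eq_measure)
    then have "ennreal ((\<Sum>s<L. real s * \<phi> s) / prob R) \<le> ennreal m"
      using assms(2) by (simp add: divide_ennreal sum_nonneg)
    then have "(\<Sum>s<L. real s * \<phi> s) / prob R \<le> m"
      by (simp add: m_def)
    then show ?thesis using assms(2) by (simp add: qR field_simps)
  qed
  moreover have "m \<ge> 0" by (simp add: m_def)
  ultimately show ?thesis by blast
qed

section \<open>Second moment carried by rare events\<close>

lemma local_time_eq_card: "local_time G (\<lambda>i y. y i) n y x = card {i. i \<le> n \<and> pos x i = y}"
  by (simp add: local_time_def sum_of_bool_eq Int_def)

lemma local_time_sum_eq_steps:
  "local_time_sum G \<xi> f n \<omega> = local_time_sum G (\<lambda>i y. y i) f n (steps \<omega>)"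
  unfolding local_time_sum_def local_time_def walk_eq_pos ..

lemma determined_by_local_time_sum:
  "determined_by (n - 1) (local_time_sum G (\<lambda>i y. y i) f n)"
  unfolding determined_by_def
proof (intro allI impI)
  fix x y :: "nat \<Rightarrow> 'g" assume "\<forall>i\<in>{1..n - 1}. x i = y i"
  then have "pos x i = pos y i" if "i \<le> n - 1" for i using that by (intro pos_cong) auto
  then show "local_time_sum G (\<lambda>i y. y i) f n x = local_time_sum G (\<lambda>i y. y i) f n y"
    unfolding local_time_sum_def local_time_def by (intro infsum_cong arg_cong[where f = f] sum.cong) auto
qed

lemma returns_le_local_time:
  assumes "carrier_valued x" "k + t \<le> n"
  shows "returns t (shift k x) \<le> local_time G (\<lambda>i y. y i) n (pos x k) x"
proof -
  have "returns t (shift k x) = card ((\<lambda>i. k + i) ` {i \<in> {1..t}. pos (shift k x) i = \<one>})"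
    unfolding returns_def by (simp add: card_image)
  also have "\<dots> \<le> card {i. i \<le> n \<and> pos x i = pos x k}"
    using assms pos_add_eq_iff[OF assms(1), of k] by (intro card_mono) auto
  finally show ?thesis by (simp add: local_time_eq_card)
qed

text \<open>Only the diagonal terms of the square are kept, one for each site first visited at a time in
  \<open>S\<close>. Restricting those times to the first half of the walk leaves a further time span \<open>t\<close> for the
  returns.\<close>

lemma local_time_sum_square_ge:
  fixes f :: "nat \<Rightarrow> real"
  assumes x: "carrier_valued x" and "f 0 = 0" and f_pos: "\<And>j. 0 \<le> f j"
    and f_sq: "\<And>j. j \<ge> 1 \<Longrightarrow> (f j)\<^sup>2 = (1 / q) ^ j" and q: "0 < q" "q < 1"
    and S: "S \<subseteq> {k. k < t \<and> new_site k x}"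
  shows "(\<Sum>k\<in>S. (1 / q) ^ returns t (shift k x)) \<le> (local_time_sum G (\<lambda>i y. y i) f (2 * t) x)\<^sup>2"
proof -
  let ?l = "\<lambda>y. local_time G (\<lambda>i y. y i) (2 * t - 1) y x"
  let ?R = "pos x ` {i. i \<le> 2 * t - 1}"
  have fin: "finite ?R" by simp
  have "local_time_sum G (\<lambda>i y. y i) f (2 * t) x = infsum (\<lambda>y. f (?l y)) (?R)"
    unfolding local_time_sum_def
  proof (rule infsum_cong_neutral)
    fix y assume "y \<in> carrier G - ?R"
    then have "{i. i \<le> 2 * t - 1 \<and> pos x i = y} = {}" by auto
    then show "f (?l y) = 0" unfolding local_time_eq_card using assms(2) by (simp only: card.empty)
  qed (use pos_carrier[OF x] in auto)
  also have "\<dots> = (\<Sum>y\<in>?R. f (?l y))" by simp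
  finally have G: "local_time_sum G (\<lambda>i y. y i) f (2 * t) x = (\<Sum>y\<in>?R. f (?l y))" .
  have inj: "inj_on (pos x) S"
    using S unfolding new_site_def by (intro linorder_inj_onI') force
  have "(\<Sum>k\<in>S. (1 / q) ^ returns t (shift k x)) \<le> (\<Sum>k\<in>S. (f (?l (pos x k)))\<^sup>2)"
  proof (rule sum_mono)
    fix k assume "k \<in> S"
    then have k: "k < t" using S by auto
    have "k \<in> {i. i \<le> 2 * t - 1 \<and> pos x i = pos x k}" using k by auto
    moreover have "finite {i. i \<le> 2 * t - 1 \<and> pos x i = pos x k}" by simp
    ultimately have "0 < ?l (pos x k)"
      unfolding local_time_eq_card by (subst card_gt_0_iff) blast
    then have "?l (pos x k) \<ge> 1" by simp
    moreover have "returns t (shift k x) \<le> ?l (pos x k)"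
      using k by (intro returns_le_local_time x) auto
    ultimately show "(1 / q) ^ returns t (shift k x) \<le> (f (?l (pos x k)))\<^sup>2"
      using q by (simp only: f_sq) (intro power_increasing, auto)
  qed
  also have "\<dots> = (\<Sum>y\<in>pos x ` S. (f (?l y))\<^sup>2)"
    by (simp add: sum.reindex[OF inj])
  also have "\<dots> \<le> (\<Sum>y\<in>?R. (f (?l y))\<^sup>2)"
    using S by (intro sum_mono2 fin image_mono) auto
  also have "\<dots> \<le> (\<Sum>y\<in>?R. f (?l y))\<^sup>2"
    by (intro sum_squares_le_square_sum fin f_pos)
  finally show ?thesis unfolding G .
qed

definition clustering :: "nat \<Rightarrow> nat \<Rightarrow> (nat \<Rightarrow> 'g) \<Rightarrow> bool" where
  "clustering N t x \<longleftrightarrow> (\<exists>k<t. N \<le> returns t (shift k x))"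

lemma event_shift_returns_ge: "{\<omega> \<in> space M. N \<le> returns t (shift k (steps \<omega>))} \<in> events"
  by (rule event_of_steps[OF determined_by_shift[OF determined_by_returns_ge]])

lemma clustering_eq_UN: "{\<omega> \<in> space M. clustering N t (steps \<omega>)}
    = (\<Union>k<t. {\<omega> \<in> space M. N \<le> returns t (shift k (steps \<omega>))})"
  unfolding clustering_def by blast

lemma event_clustering: "{\<omega> \<in> space M. clustering N t (steps \<omega>)} \<in> events"
  unfolding clustering_eq_UN using event_shift_returns_ge by blast

lemma prob_clustering_le: "prob {\<omega> \<in> space M. clustering N t (steps \<omega>)} \<le> real t * q ^ N"
proof -
  have "prob {\<omega> \<in> space M. clustering N t (steps \<omega>)}
      \<le> (\<Sum>k<t. prob {\<omega> \<in> space M. N \<le> returns t (shift k (steps \<omega>))})"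
    unfolding clustering_eq_UN using event_shift_returns_ge
    by (intro finite_measure_subadditive_finite) auto
  also have "\<dots> \<le> (\<Sum>k<t. q ^ N)"
    using returns_prob_le unfolding returns_prob_def by (intro sum_mono) (subst prob_shift[OF determined_by_returns_ge], auto)
  finally show ?thesis by simp
qed

text \<open>In expectation, every new site found up to time \<open>t\<close> and every level \<open>j\<close> between \<open>N\<close> and \<open>2 * N\<close>
  contribute at least \<open>(1 - q) * (1 / q) ^ j * (q ^ j / 2)\<close>, a quantity free of \<open>j\<close>.\<close>

lemma second_moment_on_clustering_ge:
  fixes f :: "nat \<Rightarrow> real"
  assumes f: "f 0 = 0" "\<And>j. 0 \<le> f j" "\<And>j. j \<ge> 1 \<Longrightarrow> (f j)\<^sup>2 = (1 / q) ^ j"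
    and q: "0 < q" "q < 1"
    and mom: "\<And>L. (\<Sum>s<L. real s * \<phi> s) \<le> q * m"
    and t: "4 * real N * m \<le> real t" and m: "0 \<le> m"
  shows "ennreal ((1 - q)\<^sup>2 * real t * real N / 2)
    \<le> (\<integral>\<^sup>+ \<omega>. ennreal ((local_time_sum G \<xi> f (2 * t) \<omega>)\<^sup>2)
        * indicator {\<omega> \<in> space M. clustering N t (steps \<omega>)} \<omega> \<partial>M)"
proof -
  define E where "E k j = {\<omega> \<in> space M. new_site k (steps \<omega>) \<and> j \<le> returns t (shift k (steps \<omega>))}" for k j
  have "E k j = {\<omega> \<in> space M. new_site k (steps \<omega>)} \<inter> {\<omega> \<in> space M. j \<le> returns t (shift k (steps \<omega>))}" for k j
    unfolding E_def by blast
  then have E: "E k j \<in> events" for k j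
    using event_shift_returns_ge event_of_steps[OF determined_by_new_site] by auto
  define W where "W \<omega> = (\<Sum>k<t. \<Sum>j\<in>{N<..2 * N}. ((1 - q) * (1 / q) ^ j) * indicat_real (E k j) \<omega>)" for \<omega>
  have int: "integrable M (\<lambda>\<omega>. c * indicat_real (E k j) \<omega>)" for c k j
    using E by (intro integrable_mult_right integrable_real_indicator) (auto simp: emeasure_eq_measure)
  have intW: "integrable M W"
    unfolding W_def by (intro Bochner_Integration.integrable_sum int)
  have W_nonneg: "0 \<le> W \<omega>" for \<omega> unfolding W_def using q by (intro sum_nonneg) auto
  have pE: "prob (E k j) = prob {\<omega> \<in> space M. new_site k (steps \<omega>)} * returns_prob j t" for k j
    unfolding E_def returns_prob_def by (rule prob_past_future[OF determined_by_new_site determined_by_returns_ge])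
  have "(1 - q)\<^sup>2 * real t * real N / 2 = real t * (1 - q) * ((1 - q) * (real N / 2))"
    by (simp add: power2_eq_square)
  also have "\<dots> \<le> (\<Sum>k<t. prob {\<omega> \<in> space M. new_site k (steps \<omega>)}) * ((1 - q) * (real N / 2))"
    using q by (intro mult_right_mono sum_prob_new_site_ge) auto
  also have "\<dots> = (\<Sum>k<t. \<Sum>j\<in>{N<..2 * N}. prob {\<omega> \<in> space M. new_site k (steps \<omega>)} * ((1 - q) * (1 / 2)))"
  proof -
    have "(\<Sum>j\<in>{N<..2 * N}. p * ((1 - q) * (1 / 2))) = p * ((1 - q) * (real N / 2))" for p by simp
    then show ?thesis by (simp only: sum_distrib_right)
  qed
  also have "\<dots> \<le> (\<Sum>k<t. \<Sum>j\<in>{N<..2 * N}. ((1 - q) * (1 / q) ^ j) * prob (E k j))"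
  proof (intro sum_mono)
    fix k j assume j: "j \<in> {N<..2 * N}"
    have "2 * real j * m \<le> 2 * real (2 * N) * m"
      using j m by (intro mult_right_mono) auto
    also have "\<dots> \<le> real t" using t by simp
    finally have "q ^ j / 2 \<le> returns_prob j t" by (rule returns_prob_ge[OF mom])
    then have "1 / 2 \<le> (1 / q) ^ j * returns_prob j t" using q by (simp add: field_simps power_divide)
    then have "prob {\<omega> \<in> space M. new_site k (steps \<omega>)} * ((1 - q) * (1 / 2))
       \<le> prob {\<omega> \<in> space M. new_site k (steps \<omega>)} * ((1 - q) * ((1 / q) ^ j * returns_prob j t))"
      using q by (intro mult_left_mono) auto
    then show "prob {\<omega> \<in> space M. new_site k (steps \<omega>)} * ((1 - q) * (1 / 2))
       \<le> ((1 - q) * (1 / q) ^ j) * prob (E k j)" unfolding pE by (simp only: mult_ac)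
  qed
  also have "\<dots> = (\<Sum>k<t. \<Sum>j\<in>{N<..2 * N}. expectation (\<lambda>\<omega>. ((1 - q) * (1 / q) ^ j) * indicat_real (E k j) \<omega>))"
    by (simp add: Int_absorb2 sets.sets_into_space[OF E])
  also have "\<dots> = expectation W"
    unfolding W_def
    by (simp only: Bochner_Integration.integral_sum Bochner_Integration.integrable_sum int)
  finally have "ennreal ((1 - q)\<^sup>2 * real t * real N / 2) \<le> ennreal (expectation W)" by (rule ennreal_leI)
  also have "\<dots> = (\<integral>\<^sup>+ \<omega>. ennreal (W \<omega>) \<partial>M)"
    by (rule nn_integral_eq_integral[symmetric, OF intW]) (use W_nonneg in auto)
  also have "\<dots> \<le> (\<integral>\<^sup>+ \<omega>. ennreal ((local_time_sum G \<xi> f (2 * t) \<omega>)\<^sup>2)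
        * indicator {\<omega> \<in> space M. clustering N t (steps \<omega>)} \<omega> \<partial>M)"
  proof (rule nn_integral_mono)
    fix \<omega> assume \<omega>: "\<omega> \<in> space M"
    let ?x = "steps \<omega>"
    let ?R = "\<lambda>k. returns t (shift k ?x)"
    define S where "S = {k. k < t \<and> new_site k ?x \<and> N \<le> ?R k}"
    have "W \<omega> = (\<Sum>k<t. of_bool (new_site k ?x) * ((1 - q) * (\<Sum>j\<in>{N<..2 * N}. (1 / q) ^ j * of_bool (j \<le> ?R k))))"
      unfolding W_def sum_distrib_left using \<omega>
      by (intro sum.cong refl) (simp add: E_def indicator_def)
    also have "\<dots> \<le> (\<Sum>k<t. of_bool (new_site k ?x) * ((1 / q) ^ ?R k * of_bool (N \<le> ?R k)))"
      using excursion_power_ge[OF q] by (intro sum_mono mult_left_mono) auto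
    also have "\<dots> = (\<Sum>k\<in>S. (1 / q) ^ ?R k)"
      by (intro sum.mono_neutral_cong_right) (auto simp: S_def)
    finally have W: "W \<omega> \<le> (\<Sum>k\<in>S. (1 / q) ^ ?R k)" .
    show "ennreal (W \<omega>) \<le> ennreal ((local_time_sum G \<xi> f (2 * t) \<omega>)\<^sup>2)
        * indicator {\<omega> \<in> space M. clustering N t (steps \<omega>)} \<omega>"
    proof (cases "clustering N t ?x")
      case True
      note W
      also have "(\<Sum>k\<in>S. (1 / q) ^ ?R k) \<le> (local_time_sum G (\<lambda>i y. y i) f (2 * t) ?x)\<^sup>2"
        by (rule local_time_sum_square_ge[OF carrier_valued_steps[OF \<omega>] f q]) (auto simp: S_def)
      finally show ?thesis
        using True \<omega> by (simp add: local_time_sum_eq_steps ennreal_leI)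
    next
      case False
      then have "S = {}" unfolding S_def clustering_def by auto
      then show ?thesis using W W_nonneg[of \<omega>] by simp
    qed
  qed
  finally show ?thesis .
qed

text \<open>A limit \<open>Y\<close> would bound the second moment of \<open>G\<^sub>n(f) / n\<close> on the rare event by
  \<open>2 * E (G\<^sub>n(f) / n - Y)\<^sup>2 + 2 * E (Y\<^sup>2; A\<^sub>n)\<close>, which tends to \<open>0\<close>; a subsequence of \<open>n\<close> suffices.\<close>

lemma not_L2_convergent:
  fixes f :: "nat \<Rightarrow> real"
  assumes f: "f 0 = 0" "\<And>j. 0 \<le> f j" "\<And>j. j \<ge> 1 \<Longrightarrow> (f j)\<^sup>2 = (1 / q) ^ j"
    and q: "0 < q" "q < 1"
    and mom: "\<And>L. (\<Sum>s<L. real s * \<phi> s) \<le> q * m" and m: "0 \<le> m"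
  shows "\<not> converges_in_L2 M (\<lambda>n \<omega>. local_time_sum G \<xi> f n \<omega> / real n)"
proof
  let ?X = "\<lambda>n \<omega>. local_time_sum G \<xi> f n \<omega> / real n"
  assume "converges_in_L2 M ?X"
  then obtain Y where Y [measurable]: "Y \<in> borel_measurable M" and Y2: "integrable M (\<lambda>\<omega>. (Y \<omega>)\<^sup>2)"
    and lim: "(\<lambda>n. \<integral>\<^sup>+ \<omega>. ennreal ((?X n \<omega> - Y \<omega>)\<^sup>2) \<partial>M) \<longlonglongrightarrow> 0"
    unfolding converges_in_L2_def by blast
  obtain K :: nat where K: "m \<le> real K" "1 \<le> K"
    using real_arch_simple[of "max m 1"] by auto
  \<comment> \<open>Half of the walk: at least twice the mean duration \<open>2 * N * m\<close> of \<open>2 * N\<close> returns, as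
    \<open>m \<le> K\<close>.\<close>
  define t where "t N = 4 * K * N" for N
  define A where "A N = {\<omega> \<in> space M. clustering N (t N) (steps \<omega>)}" for N
  \<comment> \<open>The lower bound \<open>(1 - q)\<^sup>2 * t * N / 2\<close> divided by \<open>n\<^sup>2\<close>, where \<open>n = 2 * t = 8 * K * N\<close>.\<close>
  define c where "c = (1 - q)\<^sup>2 / (32 * real K)"
  have [measurable]: "A N \<in> events" for N unfolding A_def by (rule event_clustering)
  have G_meas [measurable]: "local_time_sum G \<xi> f n \<in> borel_measurable M" for n
  proof -
    have "(\<lambda>\<omega>. local_time_sum G (\<lambda>i y. y i) f n (steps \<omega>)) \<in> borel_measurable M"
      by (rule measurable_of_steps[OF determined_by_local_time_sum]) simp
    then show ?thesis by (simp add: local_time_sum_eq_steps[abs_def])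
  qed
  \<comment> \<open>The exponential bound makes the probabilities summable, so dominated convergence applies to \<open>Y\<^sup>2\<close>
    on the rare events.\<close>
  have "AE \<omega> in M. eventually (\<lambda>N. \<omega> \<in> space M - A N) sequentially"
  proof (rule borel_cantelli_AE1)
    have sm: "summable (\<lambda>N. 4 * real K * (real N * q ^ N))"
    proof (rule summable_mult)
      have "summable (\<lambda>N. diffs (\<lambda>_. 1) N * q ^ N)"
        by (rule termdiff_converges[of _ 1]) (use q in \<open>auto intro: summable_geometric\<close>)
      then have "summable (\<lambda>N. q * (real (Suc N) * q ^ N))"
        by (intro summable_mult) (simp add: diffs_def)
      then have "summable (\<lambda>N. real (Suc N) * q ^ Suc N)" by (simp add: mult_ac)
      then show "summable (\<lambda>N. real N * q ^ N)"
        using summable_Suc_iff[of "\<lambda>N. real N * q ^ N"] by simp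
    qed
    have le: "norm (prob (A N)) \<le> 4 * real K * (real N * q ^ N)" for N
      using prob_clustering_le[of N "t N"] by (simp add: A_def t_def mult_ac)
    show "summable (\<lambda>N. prob (A N))"
      by (rule summable_comparison_test'[OF sm, of 0]) (rule le)
  qed (auto simp: emeasure_eq_measure)
  then have Y_lim: "(\<lambda>N. \<integral>\<^sup>+ \<omega>. ennreal ((Y \<omega>)\<^sup>2) * indicator (A N) \<omega> \<partial>M) \<longlonglongrightarrow> (\<integral>\<^sup>+ \<omega>. 0 \<partial>M)"
  proof (intro nn_integral_dominated_convergence[where w = "\<lambda>\<omega>. ennreal ((Y \<omega>)\<^sup>2)"])
    assume ev: "AE \<omega> in M. eventually (\<lambda>N. \<omega> \<in> space M - A N) sequentially"
    show "AE \<omega> in M. (\<lambda>N. ennreal ((Y \<omega>)\<^sup>2) * indicator (A N) \<omega>) \<longlonglongrightarrow> 0"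
      using ev
    proof eventually_elim
      case (elim \<omega>)
      then have "eventually (\<lambda>N. ennreal ((Y \<omega>)\<^sup>2) * indicator (A N) \<omega> = 0) sequentially"
        by eventually_elim auto
      then show ?case by (rule tendsto_eventually)
    qed
    show "(\<integral>\<^sup>+ \<omega>. ennreal ((Y \<omega>)\<^sup>2) \<partial>M) < \<infinity>"
      using Y2 by (subst nn_integral_eq_integral) auto
  qed (auto simp: indicator_def)
  have bound: "ennreal c \<le> 2 * (\<integral>\<^sup>+ \<omega>. ennreal ((?X (2 * t N) \<omega> - Y \<omega>)\<^sup>2) \<partial>M)
      + 2 * (\<integral>\<^sup>+ \<omega>. ennreal ((Y \<omega>)\<^sup>2) * indicator (A N) \<omega> \<partial>M)" if N: "N \<ge> 1" for N
  proof -
    define d where "d = (real (2 * t N))\<^sup>2"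
    have d: "d > 0" using K N by (auto simp: d_def t_def)
    have "4 * real N * m \<le> 4 * real N * real K" using K by (intro mult_left_mono) auto
    also have "\<dots> = real (t N)" by (simp add: t_def)
    finally have tN: "4 * real N * m \<le> real (t N)" .
    have "c = (1 - q)\<^sup>2 * real (t N) * real N / 2 / d"
      using K N by (simp add: c_def d_def t_def power2_eq_square field_simps)
    then have "ennreal c = ennreal (1 / d) * ennreal ((1 - q)\<^sup>2 * real (t N) * real N / 2)"
      using d by (subst ennreal_mult[symmetric]) auto
    also have "\<dots> \<le> ennreal (1 / d) * (\<integral>\<^sup>+ \<omega>. ennreal ((local_time_sum G \<xi> f (2 * t N) \<omega>)\<^sup>2) * indicator (A N) \<omega> \<partial>M)"
      unfolding A_def by (intro mult_left_mono second_moment_on_clustering_ge[OF f q mom tN m]) auto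
    also have "\<dots> = (\<integral>\<^sup>+ \<omega>. ennreal (1 / d) * (ennreal ((local_time_sum G \<xi> f (2 * t N) \<omega>)\<^sup>2) * indicator (A N) \<omega>) \<partial>M)"
      by (rule nn_integral_cmult[symmetric]) measurable
    also have "\<dots> \<le> (\<integral>\<^sup>+ \<omega>. 2 * ennreal ((?X (2 * t N) \<omega> - Y \<omega>)\<^sup>2) + 2 * (ennreal ((Y \<omega>)\<^sup>2) * indicator (A N) \<omega>) \<partial>M)"
    proof (rule nn_integral_mono)
      fix \<omega>
      let ?x = "?X (2 * t N) \<omega>" and ?y = "Y \<omega>"
      have "?x\<^sup>2 \<le> 2 * (?x - ?y)\<^sup>2 + 2 * ?y\<^sup>2"
        using zero_le_power2[of "?x - 2 * ?y"] by (simp add: power2_eq_square algebra_simps)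
      then have "ennreal (?x\<^sup>2) \<le> 2 * ennreal ((?x - ?y)\<^sup>2) + 2 * ennreal (?y\<^sup>2)"
        by (simp add: ennreal_leI flip: ennreal_plus ennreal_mult ennreal_numeral)
      moreover have "ennreal (1 / d) * ennreal ((local_time_sum G \<xi> f (2 * t N) \<omega>)\<^sup>2) = ennreal (?x\<^sup>2)"
        using d by (subst ennreal_mult[symmetric]) (auto simp: d_def power_divide)
      ultimately show "ennreal (1 / d) * (ennreal ((local_time_sum G \<xi> f (2 * t N) \<omega>)\<^sup>2) * indicator (A N) \<omega>)
         \<le> 2 * ennreal ((?x - ?y)\<^sup>2) + 2 * (ennreal (?y\<^sup>2) * indicator (A N) \<omega>)"
        by (cases "\<omega> \<in> A N") auto
    qed
    also have "\<dots> = 2 * (\<integral>\<^sup>+ \<omega>. ennreal ((?X (2 * t N) \<omega> - Y \<omega>)\<^sup>2) \<partial>M)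
      + 2 * (\<integral>\<^sup>+ \<omega>. ennreal ((Y \<omega>)\<^sup>2) * indicator (A N) \<omega> \<partial>M)"
      by (subst nn_integral_add) (auto simp: nn_integral_cmult)
    finally show ?thesis .
  qed
  have sub: "filterlim (\<lambda>N. 2 * t N) sequentially sequentially"
    using K by (intro filterlim_subseq strict_monoI) (auto simp: t_def)
  have "(\<lambda>N. 2 * (\<integral>\<^sup>+ \<omega>. ennreal ((?X (2 * t N) \<omega> - Y \<omega>)\<^sup>2) \<partial>M)
      + 2 * (\<integral>\<^sup>+ \<omega>. ennreal ((Y \<omega>)\<^sup>2) * indicator (A N) \<omega> \<partial>M)) \<longlonglongrightarrow> 2 * 0 + 2 * 0"
    using Y_lim by (intro tendsto_add ennreal_tendsto_cmult filterlim_compose[OF lim sub]) auto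
  then have "ennreal c \<le> 2 * 0 + 2 * 0"
    by (rule LIMSEQ_le_const) (use bound in blast)
  moreover have "c > 0" using q K by (simp add: c_def)
  ultimately show False by simp
qed

end

theorem mainTheorem3:
  fixes G :: "('g, 'b) monoid_scheme" and M :: "'a measure" and \<xi> :: "nat \<Rightarrow> 'a \<Rightarrow> 'g"
    and \<gamma> :: real and \<tau> :: "'a \<Rightarrow> enat" and f :: "nat \<Rightarrow> real"
  assumes "random_walk G M \<xi>"
    and "transient G M \<xi>"
    and "\<gamma> = escape_prob G M \<xi>"
    and "\<tau> = return_time G \<xi>"
    and "measure M {\<omega> \<in> space M. \<tau> \<omega> < \<infinity>} > 0"
    and "(\<integral>\<^sup>+ \<omega>. ennreal_of_enat (\<tau> \<omega>) \<partial>uniform_measure M {\<omega> \<in> space M. \<tau> \<omega> < \<infinity>}) < \<infinity>"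
    and "f 0 = 0"
    and "\<And>j. j \<ge> 1 \<Longrightarrow> f j = (1 - \<gamma>) powr (- real j / 2)"
  shows "(\<Sum>j. ennreal ((f (Suc j))\<^sup>2 * (1 - \<gamma>) ^ Suc j / real (Suc j))) = \<infinity>
    \<and> (\<forall>\<delta>::real. \<delta> > 0 \<longrightarrow>
        (\<Sum>j. ennreal ((f (Suc j))\<^sup>2 * (1 - \<gamma>) ^ Suc j / real (Suc j) powr (1 + \<delta>))) < \<infinity>)
    \<and> \<not> converges_in_L2 M (\<lambda>n \<omega>. local_time_sum G \<xi> f n \<omega> / real n)"
proof -
  interpret random_walk G M \<xi> by (rule assms(1))
  have \<gamma>: "1 - \<gamma> = q" using assms(3) by (simp add: q_def)
  have q1: "q < 1" using assms(2) by (simp add: q_def transient_def)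
  have q0: "0 < q" using assms(5) unfolding q_eq assms(4) return_time_finite_iff .
  have f_sq: "(f j)\<^sup>2 = (1 / q) ^ j" if "j \<ge> 1" for j
  proof -
    have "(f j)\<^sup>2 = (q powr (- real j / 2)) powr 2"
      using assms(8)[OF that] q0 \<gamma> by (simp add: powr_numeral)
    also have "\<dots> = q powr (- real j)" by (simp only: powr_powr) simp
    also have "\<dots> = (1 / q) ^ j" using q0 by (simp add: powr_minus powr_realpow divide_inverse power_inverse)
    finally show ?thesis .
  qed
  have f_nonneg: "0 \<le> f j" for j
    using assms(7) assms(8)[of j] by (cases "j = 0") auto
  have one: "(f (Suc j))\<^sup>2 * (1 - \<gamma>) ^ Suc j = 1" for j
    using q0 by (subst f_sq) (auto simp: \<gamma> power_divide)
  have "(\<Sum>j. ennreal (1 / real (Suc j))) = \<infinity>"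
  proof (rule ccontr)
    assume "\<not> ?thesis"
    then have "summable (\<lambda>j. 1 / real (Suc j))"
      by (intro summable_suminf_not_top) auto
    then have "summable (\<lambda>j. real (Suc j) powr - 1)" by (simp add: powr_minus divide_inverse)
    then show False
      unfolding summable_Suc_iff[of "\<lambda>j. real j powr - 1"] summable_real_powr_iff by simp
  qed
  moreover have "(\<Sum>j. ennreal (1 / real (Suc j) powr (1 + \<delta>))) < \<infinity>" if "\<delta> > 0" for \<delta>
  proof -
    have "summable (\<lambda>j. real j powr - (1 + \<delta>))"
      using that by (simp only: summable_real_powr_iff)
    then have "summable (\<lambda>j. real (Suc j) powr - (1 + \<delta>))"
      by (simp only: summable_Suc_iff[of "\<lambda>j. real j powr - (1 + \<delta>)"])
    then have "summable (\<lambda>j. 1 / real (Suc j) powr (1 + \<delta>))"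
      by (simp only: powr_minus divide_inverse mult_1_left)
    then show ?thesis by (subst suminf_ennreal2) auto
  qed
  moreover have "\<not> converges_in_L2 M (\<lambda>n \<omega>. local_time_sum G \<xi> f n \<omega> / real n)"
  proof -
    obtain m where "0 \<le> m" "\<And>L. (\<Sum>s<L. real s * \<phi> s) \<le> q * m"
      using first_moment_bound assms(5,6) unfolding assms(4) by blast
    then show ?thesis
      by (intro not_L2_convergent[OF assms(7) f_nonneg f_sq q0 q1]) auto
  qed
  ultimately show ?thesis unfolding one by blast
qed

end
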